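(* Let $R$ be a Noetherian commutative ring, and let $0 \neq g \in R[\![X]\!]$. Let $k$ be the maximum of the numbers $\mu(c(g)_{\mathfrak{m}})$, taken over all maximal ideals $\mathfrak{m}$ of $R$. (In particular, $\mu(c(g)) \geq k$.) Then for all $f \in R[\![X]\!]$, we have $$c(f)^k c(g) = c(f)^{k-1} c(fg).$$
   Context: All rings are commutative with identity. For a power series $f \in R[\![X]\!]$ (in one variable $X$), the content $c(f)$ is the ideal of $R$ generated by all the coefficients of $f$. For a finitely generated ideal $I$, $\mu(I)$ denotes the minimal number of generators of $I$; for a maximal ideal $\mathfrak{m}$ of $R$, $c(g)_{\mathfrak{m}}$ is the localization of $c(g)$ at $\mathfrak{m}$, an ideal of $R_{\mathfrak{m}}$, and $\mu(c(g)_{\mathfrak{m}})$ is its minimal number of generators over $R_{\mathfrak{m}}$. The zeroth power of any ideal of $R$ is $R$. *)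

theory Defs
  imports "HOL-Algebra.Algebra"
begin

section \<open>Power series and content\<close>

text \<open>A power series is its sequence of coefficients.  As in \<^const>\<open>UP\<close>, multiplication is the
  Cauchy product, but there is no boundedness condition on the coefficients.\<close>

definition power_series :: "('a, 'b) ring_scheme \<Rightarrow> (nat \<Rightarrow> 'a) ring"
  where "power_series R = \<lparr>
    carrier = UNIV \<rightarrow> carrier R,
    monoid.mult = (\<lambda>f g n. \<Oplus>\<^bsub>R\<^esub>i\<in>{..n}. f i \<otimes>\<^bsub>R\<^esub> g (n - i)),
    one = (\<lambda>n. if n = 0 then \<one>\<^bsub>R\<^esub> else \<zero>\<^bsub>R\<^esub>),
    ring.zero = (\<lambda>n. \<zero>\<^bsub>R\<^esub>),
    ring.add = (\<lambda>f g n. f n \<oplus>\<^bsub>R\<^esub> g n)\<rparr>"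

definition content_ideal :: "('a, 'b) ring_scheme \<Rightarrow> (nat \<Rightarrow> 'a) \<Rightarrow> 'a set"
  where "content_ideal R f = Idl\<^bsub>R\<^esub> (range f)"


section \<open>Minimal number of generators\<close>

text \<open>Meaningful for finitely generated ideals only: otherwise \<^const>\<open>Least\<close> ranges over an
  empty set.  The zero ideal is generated by the empty set, so its value is 0.\<close>

definition min_gens :: "('a, 'b) ring_scheme \<Rightarrow> 'a set \<Rightarrow> nat"
  where "min_gens R I =
    (LEAST n. \<exists>A. A \<subseteq> carrier R \<and> finite A \<and> card A = n \<and> Idl\<^bsub>R\<^esub> A = I)"


section \<open>Localization\<close>

text \<open>A pair \<open>(a, s)\<close> stands for the fraction \<open>a / s\<close>.  The factor \<open>u\<close> is needed because \<open>R\<close> may have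
  zero divisors.\<close>

definition fraction_rel :: "('a, 'b) ring_scheme \<Rightarrow> 'a set \<Rightarrow> (('a \<times> 'a) \<times> ('a \<times> 'a)) set"
  where "fraction_rel R S =
    {((a, s), (b, t)). a \<in> carrier R \<and> s \<in> S \<and> b \<in> carrier R \<and> t \<in> S \<and>
       (\<exists>u\<in>S. u \<otimes>\<^bsub>R\<^esub> (t \<otimes>\<^bsub>R\<^esub> a) = u \<otimes>\<^bsub>R\<^esub> (s \<otimes>\<^bsub>R\<^esub> b))}"

definition fraction :: "('a, 'b) ring_scheme \<Rightarrow> 'a set \<Rightarrow> 'a \<Rightarrow> 'a \<Rightarrow> ('a \<times> 'a) set"
  where "fraction R S a s = fraction_rel R S `` {(a, s)}"

text \<open>The operations on classes are lifted from representatives by taking unions; when \<open>S\<close> is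
  a multiplicative subset, all the classes in such a union are equal.\<close>

definition localization :: "('a, 'b) ring_scheme \<Rightarrow> 'a set \<Rightarrow> ('a \<times> 'a) set ring"
  where "localization R S = \<lparr>
    carrier = (carrier R \<times> S) // fraction_rel R S,
    monoid.mult = (\<lambda>A B. \<Union>(a, s)\<in>A. \<Union>(b, t)\<in>B. fraction R S (a \<otimes>\<^bsub>R\<^esub> b) (s \<otimes>\<^bsub>R\<^esub> t)),
    one = fraction R S \<one>\<^bsub>R\<^esub> \<one>\<^bsub>R\<^esub>,
    ring.zero = fraction R S \<zero>\<^bsub>R\<^esub> \<one>\<^bsub>R\<^esub>,
    ring.add = (\<lambda>A B. \<Union>(a, s)\<in>A. \<Union>(b, t)\<in>B.
             fraction R S ((t \<otimes>\<^bsub>R\<^esub> a) \<oplus>\<^bsub>R\<^esub> (s \<otimes>\<^bsub>R\<^esub> b)) (s \<otimes>\<^bsub>R\<^esub> t))\<rparr>"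

definition localize_ideal :: "('a, 'b) ring_scheme \<Rightarrow> 'a set \<Rightarrow> 'a set \<Rightarrow> ('a \<times> 'a) set set"
  where "localize_ideal R S I = {fraction R S a s | a s. a \<in> I \<and> s \<in> S}"

definition localization_at :: "('a, 'b) ring_scheme \<Rightarrow> 'a set \<Rightarrow> ('a \<times> 'a) set ring"
  where "localization_at R M = localization R (carrier R - M)"

definition localize_ideal_at :: "('a, 'b) ring_scheme \<Rightarrow> 'a set \<Rightarrow> 'a set \<Rightarrow> ('a \<times> 'a) set set"
  where "localize_ideal_at R M I = localize_ideal R (carrier R - M) I"

definition local_min_gens :: "('a, 'b) ring_scheme \<Rightarrow> 'a set \<Rightarrow> nat set"
  where "local_min_gens R I =
    {min_gens (localization_at R M) (localize_ideal_at R M I) | M. maximalideal M R}"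

end

theory Submission
  imports Defs
begin

text \<open>It suffices to compare the two ideals locally at a prime \<open>M\<close>.  Write \<open>A = c(f)\<close>, \<open>C = c(g)\<close> and let
  \<open>C\<close> be generated by \<open>k\<close> elements locally; by Nakayama's lemma we may work modulo \<open>M A\<^sup>k C\<close>.  Let \<open>a\<close>
  be the first coefficient of \<open>g\<close> outside \<open>M C\<close>.  Modulo \<open>a\<close>, the ideal \<open>C\<close> needs only \<open>k - 1\<close>
  generators, so by induction \<open>A\<^bsup>k-1\<^esup> C\<close> is contained in \<open>A\<^bsup>k-2\<^esup> c(fg) + A\<^bsup>k-1\<^esup> a\<close>.  Multiply by \<open>f\<^sub>j\<close>:
  since \<open>f\<^sub>j a\<close> is a coefficient of \<open>f g\<close> up to terms in \<open>(f\<^sub>0, \<dots>, f\<^bsub>j-1\<^esub>) C\<close> and \<open>M A C\<close>, induction on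
  \<open>j\<close> puts \<open>f\<^sub>j A\<^bsup>k-1\<^esup> C\<close> into \<open>A\<^bsup>k-1\<^esup> c(fg)\<close>.  Local statements about ideals are expressed in \<open>R\<close> itself,
  through ideals saturated with respect to the complement of \<open>M\<close>.\<close>

section \<open>Ideals saturated with respect to a multiplicative set\<close>

lemma (in cring) ideal_cringI:
  assumes "T \<subseteq> carrier R" "\<zero> \<in> T"
    and "\<And>x y. \<lbrakk>x \<in> T; y \<in> T\<rbrakk> \<Longrightarrow> x \<oplus> y \<in> T"
    and "\<And>r x. \<lbrakk>r \<in> carrier R; x \<in> T\<rbrakk> \<Longrightarrow> r \<otimes> x \<in> T"
  shows "ideal T R"
proof (rule idealI)
  have "\<ominus> x \<in> T" if "x \<in> T" for x
  proof -
    have "\<ominus> x = \<ominus> \<one> \<otimes> x"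
      using that assms(1) by (simp add: l_minus subset_iff)
    then show ?thesis
      using assms(4)[OF _ that] by simp
  qed
  then show "subgroup T (add_monoid R)"
    using assms by (auto simp: a_inv_def intro!: subgroup.intro)
  show "r \<otimes> x \<in> T" "x \<otimes> r \<in> T" if "x \<in> T" "r \<in> carrier R" for x r
    using that assms(1) assms(4)[of r x] m_comm[of x r] by auto
qed (rule ring_axioms)

lemma
  assumes "ideal T R"
  shows ideal_carr: "x \<in> T \<Longrightarrow> x \<in> carrier R"
    and ideal_zero: "\<zero>\<^bsub>R\<^esub> \<in> T"
    and ideal_add: "\<lbrakk>x \<in> T; y \<in> T\<rbrakk> \<Longrightarrow> x \<oplus>\<^bsub>R\<^esub> y \<in> T"
    and ideal_l: "\<lbrakk>r \<in> carrier R; x \<in> T\<rbrakk> \<Longrightarrow> r \<otimes>\<^bsub>R\<^esub> x \<in> T"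
    and ideal_diff: "\<lbrakk>x \<in> T; y \<in> T\<rbrakk> \<Longrightarrow> x \<ominus>\<^bsub>R\<^esub> y \<in> T"
proof -
  interpret ideal T R by fact
  show "x \<in> T \<Longrightarrow> x \<in> carrier R" "\<zero>\<^bsub>R\<^esub> \<in> T"
    "\<lbrakk>x \<in> T; y \<in> T\<rbrakk> \<Longrightarrow> x \<oplus>\<^bsub>R\<^esub> y \<in> T"
    "\<lbrakk>r \<in> carrier R; x \<in> T\<rbrakk> \<Longrightarrow> r \<otimes>\<^bsub>R\<^esub> x \<in> T"
    by (simp_all add: I_l_closed)
  then show "\<lbrakk>x \<in> T; y \<in> T\<rbrakk> \<Longrightarrow> x \<ominus>\<^bsub>R\<^esub> y \<in> T"
    by (simp add: a_minus_def)
qed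

lemma (in cring) ideal_finsum:
  assumes "ideal T R" "finite I" "\<And>i. i \<in> I \<Longrightarrow> h i \<in> T"
  shows "(\<Oplus>i\<in>I. h i) \<in> T"
  using assms(2,3)
proof (induction I rule: finite_induct)
  case empty
  then show ?case using ideal_zero[OF assms(1)] by simp
next
  case (insert i I)
  then have "h \<in> insert i I \<rightarrow> carrier R"
    using ideal_carr[OF assms(1)] by blast
  then show ?case
    using insert ideal_add[OF assms(1)] by simp
qed

definition colon :: "('a, 'b) ring_scheme \<Rightarrow> 'a set \<Rightarrow> 'a \<Rightarrow> 'a set"
  where "colon R T x = {y \<in> carrier R. x \<otimes>\<^bsub>R\<^esub> y \<in> T}"

lemma (in cring) ideal_colon:
  assumes T: "ideal T R" and x: "x \<in> carrier R"
  shows "ideal (colon R T x) R"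
proof (rule ideal_cringI)
  fix r y assume "r \<in> carrier R" "y \<in> colon R T x"
  then show "r \<otimes> y \<in> colon R T x"
    using x ideal_l[OF T, of r "x \<otimes> y"] by (simp add: colon_def m_lcomm)
qed (use x ideal_zero[OF T] ideal_add[OF T] in \<open>auto simp: colon_def r_distr\<close>)

locale multiplicative_set = cring R for R (structure) +
  fixes S
  assumes S_carrier: "S \<subseteq> carrier R"
    and S_one: "\<one> \<in> S"
    and S_mult: "\<lbrakk>s \<in> S; t \<in> S\<rbrakk> \<Longrightarrow> s \<otimes> t \<in> S"
begin

lemma S_carr: "s \<in> S \<Longrightarrow> s \<in> carrier R"
  using S_carrier by blast

definition saturated :: "'a set \<Rightarrow> bool"
  where "saturated T \<longleftrightarrow> ideal T R \<and> (\<forall>s\<in>S. \<forall>x\<in>carrier R. s \<otimes> x \<in> T \<longrightarrow> x \<in> T)"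

definition sat_hull :: "'a set \<Rightarrow> 'a set"
  where "sat_hull V = \<Inter>{T. saturated T \<and> V \<subseteq> T}"

lemma saturated_ideal: "saturated T \<Longrightarrow> ideal T R"
  by (simp add: saturated_def)

lemma saturatedD: "\<lbrakk>saturated T; s \<in> S; x \<in> carrier R; s \<otimes> x \<in> T\<rbrakk> \<Longrightarrow> x \<in> T"
  by (simp add: saturated_def)

lemma saturated_carrier: "saturated (carrier R)"
  by (simp add: saturated_def oneideal)

lemma sat_hull_least: "\<lbrakk>saturated T; V \<subseteq> T\<rbrakk> \<Longrightarrow> sat_hull V \<subseteq> T"
  by (auto simp: sat_hull_def)

lemma sat_hull_superset: "V \<subseteq> sat_hull V"
  by (auto simp: sat_hull_def)

lemma saturated_sat_hull:
  assumes "V \<subseteq> carrier R"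
  shows "saturated (sat_hull V)"
proof -
  have "ideal (sat_hull V) R"
    unfolding sat_hull_def
    using assms saturated_carrier saturated_ideal by (intro i_Intersect) blast+
  moreover have "v \<in> sat_hull V" if "s \<in> S" "v \<in> carrier R" "s \<otimes> v \<in> sat_hull V" for s v
    using that saturatedD unfolding sat_hull_def by blast
  ultimately show ?thesis
    unfolding saturated_def by blast
qed

lemma sat_hull_subset_hull: "\<lbrakk>Y \<subseteq> carrier R; V \<subseteq> sat_hull Y\<rbrakk> \<Longrightarrow> sat_hull V \<subseteq> sat_hull Y"
  by (simp add: sat_hull_least saturated_sat_hull)

lemma sat_hull_mono: "\<lbrakk>V \<subseteq> Y; Y \<subseteq> carrier R\<rbrakk> \<Longrightarrow> sat_hull V \<subseteq> sat_hull Y"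
  by (meson sat_hull_subset_hull sat_hull_superset order_trans)

lemma saturated_colon:
  assumes T: "saturated T" and x: "x \<in> carrier R"
  shows "saturated (colon R T x)"
  unfolding saturated_def
proof (intro conjI ballI impI)
  show "ideal (colon R T x) R"
    using T x by (simp add: ideal_colon saturated_ideal)
  fix s y assume "s \<in> S" "y \<in> carrier R" "s \<otimes> y \<in> colon R T x"
  then show "y \<in> colon R T x"
    using x saturatedD[OF T, of s "x \<otimes> y"] by (simp add: colon_def m_lcomm S_carr)
qed

lemma sat_hull_adjoin:
  assumes J: "saturated J" and N: "ideal N R" and y: "y \<in> carrier R"
    and x: "x \<in> sat_hull (J \<union> (\<lambda>n. n \<otimes> y) ` N)"
  obtains s b n where "s \<in> S" "b \<in> J" "n \<in> N" "s \<otimes> x = b \<oplus> n \<otimes> y"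
proof -
  note Ji = saturated_ideal[OF J]
  note [simp] = S_carr ideal_carr[OF Ji] ideal_carr[OF N] y
  let ?T = "{x \<in> carrier R. \<exists>s\<in>S. \<exists>b\<in>J. \<exists>n\<in>N. s \<otimes> x = b \<oplus> n \<otimes> y}"
  have TI: "v \<in> ?T"
    if "v \<in> carrier R" "s \<in> S" "b \<in> J" "n \<in> N" "s \<otimes> v = b \<oplus> n \<otimes> y" for v s b n
    using that by blast
  have "saturated ?T"
    unfolding saturated_def
  proof (intro conjI ballI impI)
    show "ideal ?T R"
    proof (rule ideal_cringI)
      show "\<zero> \<in> ?T"
        using S_one ideal_zero[OF Ji] ideal_zero[OF N] by (intro TI[of \<zero> \<one> \<zero> \<zero>]) simp_all
    next
      fix v w assume "v \<in> ?T" "w \<in> ?T"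
      then obtain s b n t c m where
        v: "v \<in> carrier R" "s \<in> S" "b \<in> J" "n \<in> N" "s \<otimes> v = b \<oplus> n \<otimes> y" and
        w: "w \<in> carrier R" "t \<in> S" "c \<in> J" "m \<in> N" "t \<otimes> w = c \<oplus> m \<otimes> y"
        by blast
      have "(s \<otimes> t) \<otimes> (v \<oplus> w) = t \<otimes> (s \<otimes> v) \<oplus> s \<otimes> (t \<otimes> w)"
        using v(1,2) w(1,2) by (simp add: r_distr m_ac)
      also have "\<dots> = t \<otimes> (b \<oplus> n \<otimes> y) \<oplus> s \<otimes> (c \<oplus> m \<otimes> y)"
        by (simp add: v w)
      also have "\<dots> = (t \<otimes> b \<oplus> s \<otimes> c) \<oplus> (t \<otimes> n \<oplus> s \<otimes> m) \<otimes> y"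
        using v(1-4) w(1-4) by (simp add: r_distr l_distr m_ac a_ac)
      finally show "v \<oplus> w \<in> ?T"
        using v(1-4) w(1-4) S_mult[of s t]
          ideal_add[OF Ji ideal_l[OF Ji] ideal_l[OF Ji], of t b s c]
          ideal_add[OF N ideal_l[OF N] ideal_l[OF N], of t n s m]
        by (intro TI) simp_all
    next
      fix r v assume r: "r \<in> carrier R" and "v \<in> ?T"
      then obtain s b n where
        v: "v \<in> carrier R" "s \<in> S" "b \<in> J" "n \<in> N" "s \<otimes> v = b \<oplus> n \<otimes> y"
        by blast
      have "s \<otimes> (r \<otimes> v) = r \<otimes> (b \<oplus> n \<otimes> y)"
        using v r by (simp add: m_lcomm flip: v(5))
      also have "\<dots> = r \<otimes> b \<oplus> (r \<otimes> n) \<otimes> y"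
        using v(1-4) r by (simp add: r_distr m_assoc)
      finally show "r \<otimes> v \<in> ?T"
        using v(1-4) r ideal_l[OF Ji, of r b] ideal_l[OF N, of r n] by (intro TI) simp_all
    qed auto
  next
    fix s v assume "s \<in> S" and v: "v \<in> carrier R" "s \<otimes> v \<in> ?T"
    then obtain t b n where "t \<in> S" "b \<in> J" "n \<in> N" "t \<otimes> (s \<otimes> v) = b \<oplus> n \<otimes> y"
      by blast
    moreover from this have "(t \<otimes> s) \<otimes> v = b \<oplus> n \<otimes> y"
      using \<open>s \<in> S\<close> v by (simp add: m_assoc)
    ultimately show "v \<in> ?T"
      using S_mult[of t s] \<open>s \<in> S\<close> v(1) by (intro TI)
  qed
  moreover have "J \<union> (\<lambda>n. n \<otimes> y) ` N \<subseteq> ?T"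
  proof -
    have "v \<in> ?T" if "v \<in> J" for v
      using that S_one ideal_zero[OF N] by (intro TI[of v \<one> v \<zero>]) simp_all
    moreover have "n \<otimes> y \<in> ?T" if "n \<in> N" for n
      using that S_one ideal_zero[OF Ji] by (intro TI[of _ \<one> \<zero> n]) simp_all
    ultimately show ?thesis
      by (intro Un_least image_subsetI subsetI)
  qed
  ultimately have "sat_hull (J \<union> (\<lambda>n. n \<otimes> y) ` N) \<subseteq> ?T"
    by (rule sat_hull_least)
  then have "x \<in> ?T"
    using x by (rule subsetD)
  then show ?thesis
    using that by blast
qed

end

sublocale primeideal \<subseteq> multiplicative_set R "carrier R - I"
  using I_notcarr one_imp_carrier I_prime by unfold_locales auto

context primeideal
begin

lemma sat_hull_exchange_insert:
  assumes J: "saturated J" and b: "b \<in> carrier R" "\<And>m. m \<in> I \<Longrightarrow> m \<otimes> b \<in> J"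
    and a: "a \<in> carrier R" "a \<in> sat_hull (insert b J)" "a \<notin> J"
  shows "b \<in> sat_hull (insert a J)"
proof -
  note Ji = saturated_ideal[OF J]
  have Jc: "J \<subseteq> carrier R"
    using ideal_carr[OF Ji] by blast
  have "b \<in> (\<lambda>n. n \<otimes> b) ` carrier R"
    using b(1) by (intro image_eqI[of _ _ \<one>]) simp_all
  then have "a \<in> sat_hull (J \<union> (\<lambda>n. n \<otimes> b) ` carrier R)"
    using a(2) sat_hull_mono[of "insert b J" "J \<union> (\<lambda>n. n \<otimes> b) ` carrier R"] Jc b(1) by auto
  then obtain s c n where s: "s \<in> carrier R - I" "c \<in> J" "n \<in> carrier R" "s \<otimes> a = c \<oplus> n \<otimes> b"
    using sat_hull_adjoin[OF J oneideal b(1)] by blast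
  have "n \<notin> I"
    using b(2) s a saturatedD[OF J s(1)] ideal_add[OF Ji] by auto
  let ?K = "sat_hull (insert a J)"
  have K: "saturated ?K"
    using a(1) Jc by (intro saturated_sat_hull) auto
  have sub: "insert a J \<subseteq> ?K"
    by (rule sat_hull_superset)
  have "c \<in> carrier R"
    using s(2) Jc by blast
  then have "n \<otimes> b = s \<otimes> a \<ominus> c"
    using s b(1) by (simp add: minus_eq a_ac r_neg2)
  moreover have "s \<otimes> a \<ominus> c \<in> ?K"
    using sub s by (intro ideal_diff[OF saturated_ideal[OF K]] ideal_l[OF saturated_ideal[OF K]]) auto
  ultimately show ?thesis
    using saturatedD[OF K, of n b] s(3) \<open>n \<notin> I\<close> b(1) by simp
qed

lemma sat_hull_exchange:
  assumes "finite Z" "B \<subseteq> carrier R" "Z \<subseteq> carrier R"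
    and "\<And>m z. \<lbrakk>m \<in> I; z \<in> Z\<rbrakk> \<Longrightarrow> m \<otimes> z \<in> sat_hull B"
    and "a \<in> carrier R" "a \<in> sat_hull (B \<union> Z)" "a \<notin> sat_hull B"
  shows "\<exists>z\<in>Z. z \<in> sat_hull (insert a (B \<union> (Z - {z})))"
  using assms(1,3,4,6)
proof (induction Z rule: finite_induct)
  case empty
  then show ?case using assms(7) by simp
next
  case (insert z Z)
  then have car: "B \<union> Z \<subseteq> carrier R" "insert a (B \<union> Z) \<subseteq> carrier R" "z \<in> carrier R"
    using assms(2,5) by auto
  show ?case
  proof (cases "a \<in> sat_hull (B \<union> Z)")
    case True
    then obtain y where y: "y \<in> Z" "y \<in> sat_hull (insert a (B \<union> (Z - {y})))"
      using insert by blast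
    moreover have "insert a (B \<union> (Z - {y})) \<subseteq> insert a (B \<union> (insert z Z - {y}))"
      by blast
    moreover have "insert a (B \<union> (insert z Z - {y})) \<subseteq> carrier R"
      using car by blast
    ultimately show ?thesis
      using sat_hull_mono by blast
  next
    case False
    let ?J = "sat_hull (B \<union> Z)"
    have J: "saturated ?J"
      using car(1) by (rule saturated_sat_hull)
    have Jc: "insert z ?J \<subseteq> carrier R"
      using ideal_carr[OF saturated_ideal[OF J]] car(3) by blast
    have "B \<union> insert z Z \<subseteq> insert z ?J"
      using sat_hull_superset[of "B \<union> Z"] by blast
    then have "a \<in> sat_hull (insert z ?J)"
      using sat_hull_mono[OF _ Jc] insert.prems(3) by blast
    moreover have "m \<otimes> z \<in> ?J" if "m \<in> I" for m
      using insert.prems(2)[OF that, of z] sat_hull_mono[OF _ car(1), of B] by blast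
    ultimately have "z \<in> sat_hull (insert a ?J)"
      using sat_hull_exchange_insert[OF J car(3) _ assms(5) _ False] by blast
    moreover have "insert a ?J \<subseteq> sat_hull (insert a (B \<union> Z))"
      using sat_hull_superset[of "insert a (B \<union> Z)"] sat_hull_mono[OF _ car(2), of "B \<union> Z"] by blast
    ultimately have "z \<in> sat_hull (insert a (B \<union> Z))"
      using sat_hull_subset_hull[OF car(2)] by blast
    moreover have "insert z Z - {z} = Z"
      using insert.hyps by blast
    ultimately show ?thesis
      by auto
  qed
qed

lemma saturated_nakayama:
  assumes "finite Z" "Z \<subseteq> carrier R" and J: "saturated J"
    and "Z \<subseteq> sat_hull (J \<union> (\<Union>z\<in>Z. (\<lambda>m. m \<otimes> z) ` I))"
  shows "Z \<subseteq> J"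
  using assms(1,2,4)
proof (induction Z rule: finite_induct)
  case empty
  then show ?case by simp
next
  case (insert z Z)
  note Ji = saturated_ideal[OF J]
  let ?Y = "J \<union> (\<Union>z\<in>Z. (\<lambda>m. m \<otimes> z) ` I)"
  have z: "z \<in> carrier R" and Yc: "?Y \<subseteq> carrier R"
    using insert.prems(1) ideal_carr[OF Ji] Icarr by auto
  let ?K = "sat_hull ?Y"
  have K: "saturated ?K"
    using Yc by (rule saturated_sat_hull)
  note Ki = saturated_ideal[OF K]
  let ?L = "?K \<union> (\<lambda>m. m \<otimes> z) ` I"
  have Lc: "?L \<subseteq> carrier R"
    using ideal_carr[OF Ki] Icarr z by auto
  have "J \<union> (\<Union>y\<in>insert z Z. (\<lambda>m. m \<otimes> y) ` I) \<subseteq> ?L"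
    using sat_hull_superset[of ?Y] by blast
  then have sub: "insert z Z \<subseteq> sat_hull ?L"
    using insert.prems(2) sat_hull_mono[OF _ Lc] by blast
  then obtain s b n where s: "s \<in> carrier R - I" "b \<in> ?K" "n \<in> I" "s \<otimes> z = b \<oplus> n \<otimes> z"
    using sat_hull_adjoin[OF K ideal_axioms z] by blast
  have carr: "b \<in> carrier R" "n \<in> carrier R" "s \<in> carrier R"
    using s ideal_carr[OF Ki] Icarr by auto
  have "(s \<ominus> n) \<otimes> z = s \<otimes> z \<ominus> n \<otimes> z"
    using carr z by (simp add: minus_eq l_distr l_minus)
  also have "\<dots> = b"
    unfolding s(4) using carr z by (simp add: minus_eq a_assoc r_neg)
  finally have "(s \<ominus> n) \<otimes> z \<in> ?K"
    using s(2) by simp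
  moreover have "s \<ominus> n \<notin> I"
  proof
    assume "s \<ominus> n \<in> I"
    then have "(s \<ominus> n) \<oplus> n \<in> I"
      using s(3) by simp
    moreover have "(s \<ominus> n) \<oplus> n = s"
      using carr by (simp add: minus_eq a_assoc l_neg)
    ultimately show False
      using s(1) by simp
  qed
  ultimately have zK: "z \<in> ?K"
    using saturatedD[OF K, of "s \<ominus> n" z] carr z by simp
  then have "?L \<subseteq> ?K"
    using ideal_l[OF Ki] Icarr by auto
  then have "sat_hull ?L \<subseteq> ?K"
    using K sat_hull_least by blast
  then have "Z \<subseteq> ?K"
    using sub by blast
  then have ZJ: "Z \<subseteq> J"
    using insert.IH insert.prems(1) by blast
  then have "?Y \<subseteq> J"
    using ideal_l[OF Ji] Icarr by auto
  then have "?K \<subseteq> J"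
    using J sat_hull_least by blast
  then show ?case
    using zK ZJ by blast
qed

end

section \<open>The local Dedekind--Mertens property\<close>

lemma ideals_set_simps [simp]:
  "carrier (ideals_set R) = {J. ideal J R}" "\<one>\<^bsub>ideals_set R\<^esub> = carrier R"
  "A \<otimes>\<^bsub>ideals_set R\<^esub> B = A \<cdot>\<^bsub>R\<^esub> B"
  by (simp_all add: ideals_set_def)

lemma (in ring) ideal_pow_ideal:
  assumes "ideal A R"
  shows "ideal (A [^]\<^bsub>ideals_set R\<^esub> (n::nat)) R"
  using assms by (induction n) (simp_all add: oneideal ideal_prod_is_ideal)

lemma (in ring) ideal_prod_subsetI:
  assumes "ideal T R" "\<And>x y. \<lbrakk>x \<in> A; y \<in> B\<rbrakk> \<Longrightarrow> x \<otimes> y \<in> T"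
  shows "A \<cdot> B \<subseteq> T"
proof
  fix x assume "x \<in> A \<cdot> B"
  then show "x \<in> T"
    by induction (use assms ideal_add[OF assms(1)] in auto)
qed

lemma (in cring) genideal_colonI:
  assumes "ideal T R" "x \<in> carrier R" "Z \<subseteq> carrier R" "\<And>z. z \<in> Z \<Longrightarrow> x \<otimes> z \<in> T" "y \<in> Idl Z"
  shows "x \<otimes> y \<in> T"
proof -
  have "Idl Z \<subseteq> colon R T x"
    using assms by (intro genideal_minimal ideal_colon) (auto simp: colon_def)
  then show ?thesis
    using assms(5) by (auto simp: colon_def)
qed

lemma (in multiplicative_set) sat_hull_colonI:
  assumes "saturated T" "x \<in> carrier R" "Z \<subseteq> carrier R" "\<And>z. z \<in> Z \<Longrightarrow> x \<otimes> z \<in> T" "y \<in> sat_hull Z"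
  shows "x \<otimes> y \<in> T"
proof -
  have "sat_hull Z \<subseteq> colon R T x"
    using assms by (intro sat_hull_least saturated_colon) (auto simp: colon_def)
  then show ?thesis
    using assms(5) by (auto simp: colon_def)
qed

lemma (in ring) content_ideal_ideal:
  assumes "f \<in> UNIV \<rightarrow> carrier R"
  shows "ideal (content_ideal R f) R"
  unfolding content_ideal_def using assms by (intro genideal_ideal) auto

lemma (in ring) coeff_in_content:
  assumes "f \<in> UNIV \<rightarrow> carrier R"
  shows "f n \<in> content_ideal R f"
  unfolding content_ideal_def using assms genideal_self[of "range f"] by auto

lemma power_series_simps:
  "carrier (power_series R) = UNIV \<rightarrow> carrier R"
  "f \<otimes>\<^bsub>power_series R\<^esub> g = (\<lambda>n. \<Oplus>\<^bsub>R\<^esub>i\<in>{..n}. f i \<otimes>\<^bsub>R\<^esub> g (n - i))"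
  "\<zero>\<^bsub>power_series R\<^esub> = (\<lambda>n. \<zero>\<^bsub>R\<^esub>)"
  by (simp_all add: power_series_def)

lemma (in ring) power_series_mult_closed:
  assumes "f \<in> UNIV \<rightarrow> carrier R" "g \<in> UNIV \<rightarrow> carrier R"
  shows "f \<otimes>\<^bsub>power_series R\<^esub> g \<in> UNIV \<rightarrow> carrier R"
  using assms unfolding power_series_simps by (auto simp: Pi_iff)

lemma (in cring) content_mult_subset:
  assumes f: "f \<in> UNIV \<rightarrow> carrier R" and g: "g \<in> UNIV \<rightarrow> carrier R"
  shows "content_ideal R (f \<otimes>\<^bsub>power_series R\<^esub> g) \<subseteq> content_ideal R f \<cdot> content_ideal R g"
  unfolding content_ideal_def[of _ "f \<otimes>\<^bsub>power_series R\<^esub> g"]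
proof (intro genideal_minimal subsetI)
  show id: "ideal (content_ideal R f \<cdot> content_ideal R g) R"
    using f g by (intro ideal_prod_is_ideal content_ideal_ideal)
  fix y assume "y \<in> range (f \<otimes>\<^bsub>power_series R\<^esub> g)"
  then show "y \<in> content_ideal R f \<cdot> content_ideal R g"
    using coeff_in_content[OF f] coeff_in_content[OF g]
    by (auto simp: power_series_simps intro!: ideal_finsum[OF id] ideal_prod.prod)
qed

text \<open>In the coefficient of degree \<open>i + j\<close> of \<open>f g\<close>, the term \<open>f\<^sub>j g\<^sub>i\<close> is the only one that
  involves neither a coefficient of \<open>f\<close> before the \<open>j\<close>-th nor one of \<open>g\<close> before the \<open>i\<close>-th.\<close>

lemma (in cring) leading_term_in_ideal:
  assumes f: "f \<in> UNIV \<rightarrow> carrier R" and g: "g \<in> UNIV \<rightarrow> carrier R"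
    and T: "ideal T R" and x: "x \<in> carrier R"
    and fg: "x \<otimes> (f \<otimes>\<^bsub>power_series R\<^esub> g) (i + j) \<in> T"
    and f_lower: "\<And>p q. p < j \<Longrightarrow> x \<otimes> (f p \<otimes> g q) \<in> T"
    and g_lower: "\<And>p q. q < i \<Longrightarrow> x \<otimes> (f p \<otimes> g q) \<in> T"
  shows "x \<otimes> (f j \<otimes> g i) \<in> T"
proof -
  note Q = ideal_colon[OF T x]
  have [simp]: "f n \<in> carrier R" "g n \<in> carrier R" for n
    using f g by auto
  define h where "h p = f p \<otimes> g (i + j - p)" for p
  have h [simp]: "h p \<in> carrier R" for p
    by (simp add: h_def)
  have "(\<Oplus>p\<in>{..i + j} - {j}. h p) \<in> colon R T x"
  proof (rule ideal_finsum[OF Q])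
    fix p assume p: "p \<in> {..i + j} - {j}"
    then consider "p < j" | "i + j - p < i"
      by force
    then show "h p \<in> colon R T x"
      using f_lower g_lower by cases (auto simp: colon_def h_def)
  qed simp
  moreover have "(\<Oplus>p\<in>{..i + j}. h p) \<in> colon R T x"
    using fg by (simp add: colon_def power_series_simps h_def)
  moreover have "(\<Oplus>p\<in>{..i + j}. h p) = h j \<oplus> (\<Oplus>p\<in>{..i + j} - {j}. h p)"
    using finsum_insert[of "{..i + j} - {j}" j h] by (simp add: insert_absorb)
  ultimately have
    "(h j \<oplus> (\<Oplus>p\<in>{..i + j} - {j}. h p)) \<ominus> (\<Oplus>p\<in>{..i + j} - {j}. h p) \<in> colon R T x"
    using ideal_diff[OF Q] by metis
  then have "h j \<in> colon R T x"
    by (simp add: minus_eq a_assoc r_neg)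
  then show ?thesis
    by (simp add: colon_def h_def)
qed

text \<open>Induction on the number of elements that generate the content of \<open>g\<close> modulo \<open>B\<close>: the first
  coefficient \<open>g\<^sub>i\<close> outside the hull of \<open>B\<close> can be exchanged for one of them, and the induction
  hypothesis applies to \<open>B \<union> {g\<^sub>i}\<close> and the ideals \<open>(T : f\<^sub>j)\<close>.\<close>

lemma (in primeideal) content_pow_mult_modulo:
  assumes f: "f \<in> UNIV \<rightarrow> carrier R" and g: "g \<in> UNIV \<rightarrow> carrier R"
    and "B \<subseteq> carrier R" "finite Z" "card Z \<le> k" "Z \<subseteq> content_ideal R g"
    and "\<And>m c. \<lbrakk>m \<in> I; c \<in> content_ideal R g\<rbrakk> \<Longrightarrow> m \<otimes> c \<in> sat_hull B"
    and "content_ideal R g \<subseteq> sat_hull (B \<union> Z)"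
    and "saturated T"
    and "\<And>l x n. \<lbrakk>k = Suc l; x \<in> content_ideal R f [^]\<^bsub>ideals_set R\<^esub> l\<rbrakk> \<Longrightarrow>
      x \<otimes> (f \<otimes>\<^bsub>power_series R\<^esub> g) n \<in> T"
    and "\<And>x b. \<lbrakk>x \<in> content_ideal R f [^]\<^bsub>ideals_set R\<^esub> k; b \<in> B\<rbrakk> \<Longrightarrow> x \<otimes> b \<in> T"
    and "x \<in> content_ideal R f [^]\<^bsub>ideals_set R\<^esub> k" "c \<in> content_ideal R g"
  shows "x \<otimes> c \<in> T"
  using assms(3-)
proof (induction k arbitrary: B Z T x c)
  case 0
  have "Z = {}"
    using 0(2,3) by simp
  then have "c \<in> sat_hull B"
    using 0(6,11) by auto
  moreover have "x \<in> carrier R"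
    using 0(10) by simp
  ultimately show ?case
    using sat_hull_colonI[OF 0(7) _ 0(1) 0(9)[OF 0(10)]] by blast
next
  case (Suc k)
  let ?A = "content_ideal R f" and ?C = "content_ideal R g"
  let ?P = "\<lambda>n. ?A [^]\<^bsub>ideals_set R\<^esub> (n::nat)"
  have [simp]: "f n \<in> carrier R" "g n \<in> carrier R" "f n \<in> ?A" "g n \<in> ?C" for n
    using f g coeff_in_content by auto
  have A: "ideal ?A R" and C: "ideal ?C R" and P: "ideal (?P n) R" for n
    using f g by (simp_all add: content_ideal_ideal ideal_pow_ideal)
  note T = \<open>saturated T\<close>
  note Ti = saturated_ideal[OF T]
  note xP = ideal_carr[OF P]
  show ?case
  proof (cases "?C \<subseteq> sat_hull B")
    case True
    then show ?thesis
      using sat_hull_colonI[OF T xP[OF Suc.prems(10)] Suc.prems(1,9)] Suc.prems(10,11) by blast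
  next
    case False
    note B = \<open>B \<subseteq> carrier R\<close>
    have Zc: "Z \<subseteq> carrier R"
      using Suc.prems(4) ideal_carr[OF C] by blast
    have "\<exists>n. g n \<notin> sat_hull B"
    proof (rule ccontr)
      assume "\<not> ?thesis"
      then have "?C \<subseteq> sat_hull B"
        unfolding content_ideal_def
        by (intro genideal_minimal saturated_ideal[OF saturated_sat_hull[OF B]]) blast
      with False show False by simp
    qed
    define i where "i = (LEAST n. g n \<notin> sat_hull B)"
    have gi: "g i \<notin> sat_hull B"
      using \<open>\<exists>n. g n \<notin> sat_hull B\<close> unfolding i_def by (rule LeastI_ex)
    have low: "g q \<in> sat_hull B" if "q < i" for q
      using not_less_Least[of q "\<lambda>n. g n \<notin> sat_hull B"] that unfolding i_def by blast
    have "g i \<in> sat_hull (B \<union> Z)"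
      using Suc.prems(6) by (rule subsetD) simp
    moreover have "m \<otimes> z \<in> sat_hull B" if "m \<in> I" "z \<in> Z" for m z
      using Suc.prems(4,5) that by blast
    ultimately obtain z where z: "z \<in> Z" "z \<in> sat_hull (insert (g i) (B \<union> (Z - {z})))"
      using sat_hull_exchange[OF Suc.prems(2) B Zc _ _ _ gi] by auto
    have BZ: "insert (g i) B \<union> (Z - {z}) \<subseteq> carrier R"
      using B Zc by auto
    have "B \<union> Z \<subseteq> sat_hull (insert (g i) B \<union> (Z - {z}))"
      using sat_hull_superset[of "insert (g i) B \<union> (Z - {z})"] z by auto
    then have C_hull: "?C \<subseteq> sat_hull (insert (g i) B \<union> (Z - {z}))"
      using sat_hull_subset_hull[OF BZ] Suc.prems(6) by blast
    have card: "card (Z - {z}) \<le> k"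
      using Suc.prems(2,3) z(1) by (simp add: card_Diff_singleton)
    have mc: "m \<otimes> c \<in> sat_hull (insert (g i) B)" if "m \<in> I" "c \<in> ?C" for m c
      using Suc.prems(5)[OF that] sat_hull_mono[of B "insert (g i) B"] BZ by blast
    have xf: "x \<otimes> f p \<in> ?P (Suc k)" if "x \<in> ?P k" for x p
      using ideal_prod.prod[OF that, of "f p" ?A R] by simp
    have fj: "f j \<otimes> (x \<otimes> c) \<in> T" if "x \<in> ?P k" "c \<in> ?C" for j x c
      using that
    proof (induction j arbitrary: x c rule: less_induct)
      case (less j)
      have col: "saturated (colon R T (f j))"
        using T by (intro saturated_colon) auto
      have "x \<otimes> c \<in> colon R T (f j)"
      proof (rule Suc.IH[OF _ _ card _ mc C_hull col _ _ less.prems])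
        show "insert (g i) B \<subseteq> carrier R" "finite (Z - {z})" "Z - {z} \<subseteq> ?C"
          using B Suc.prems(2,4) by auto
      next
        fix l v n assume k: "k = Suc l" and v: "v \<in> ?P l"
        then have "(v \<otimes> f j) \<otimes> (f \<otimes>\<^bsub>power_series R\<^esub> g) n \<in> T"
          using Suc.prems(8)[of k "v \<otimes> f j" n] ideal_prod.prod[OF v, of "f j" ?A R] by simp
        moreover have "(f \<otimes>\<^bsub>power_series R\<^esub> g) n \<in> carrier R" "v \<in> carrier R"
          using power_series_mult_closed[OF f g] xP[OF v] by auto
        ultimately show "v \<otimes> (f \<otimes>\<^bsub>power_series R\<^esub> g) n \<in> colon R T (f j)"
          by (simp add: colon_def m_ac)
      next
        fix v b assume v: "v \<in> ?P k" and b: "b \<in> insert (g i) B"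
        note vc = xP[OF v]
        have "f j \<otimes> (v \<otimes> b) \<in> T"
        proof (cases "b \<in> B")
          case True
          then have "(v \<otimes> f j) \<otimes> b \<in> T" "b \<in> carrier R"
            using Suc.prems(9)[OF xf[OF v]] B by blast+
          then show ?thesis
            using vc by (simp add: m_ac)
        next
          case False
          have "v \<otimes> (f j \<otimes> g i) \<in> T"
          proof (rule leading_term_in_ideal[OF f g Ti vc])
            show "v \<otimes> (f \<otimes>\<^bsub>power_series R\<^esub> g) (i + j) \<in> T"
              by (rule Suc.prems(8)[OF refl v])
            show "v \<otimes> (f p \<otimes> g q) \<in> T" if "p < j" for p q
              using less.IH[OF that v, of "g q"] vc by (simp add: m_ac)
            show "v \<otimes> (f p \<otimes> g q) \<in> T" if "q < i" for p q
            proof -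
              have "(v \<otimes> f p) \<otimes> g q \<in> T"
                using Suc.prems(9)[OF xf[OF v]]
                by (rule sat_hull_colonI[OF T xP[OF xf[OF v]] B _ low[OF that]])
              then show ?thesis
                using vc by (simp add: m_assoc)
            qed
          qed
          then show ?thesis
            using False b vc by (simp add: m_ac)
        qed
        moreover have "b \<in> carrier R"
          using b B by auto
        ultimately show "v \<otimes> b \<in> colon R T (f j)"
          using vc by (simp add: colon_def)
      qed
      then show ?case
        by (simp add: colon_def)
    qed
    have cc: "c \<in> carrier R"
      using Suc.prems(11) ideal_carr[OF C] by blast
    have "?P k \<cdot> ?A \<subseteq> colon R T c"
    proof (rule ideal_prod_subsetI[OF ideal_colon[OF Ti cc]])
      fix v a assume v: "v \<in> ?P k" and a: "a \<in> ?A"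
      note vc = xP[OF v] and ac = ideal_carr[OF A a]
      have "(v \<otimes> c) \<otimes> a \<in> T"
      proof (rule genideal_colonI[OF Ti])
        show "a \<in> Idl (range f)"
          using a by (simp add: content_ideal_def)
        fix y assume "y \<in> range f"
        then obtain j where "y = f j"
          by blast
        then show "(v \<otimes> c) \<otimes> y \<in> T"
          using fj[OF v Suc.prems(11), of j] vc cc by (simp add: m_ac)
      next
        show "v \<otimes> c \<in> carrier R" "range f \<subseteq> carrier R"
          using vc cc f by auto
      qed
      then show "v \<otimes> a \<in> colon R T c"
        using vc ac cc by (simp add: colon_def m_ac)
    qed
    then have "x \<in> colon R T c"
      using Suc.prems(10) by auto
    then show ?thesis
      using cc by (simp add: colon_def m_comm)
  qed
qed

lemma (in primeideal) content_pow_mult_local: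
  assumes f: "f \<in> UNIV \<rightarrow> carrier R" and g: "g \<in> UNIV \<rightarrow> carrier R"
    and noeth: "noetherian_ring R"
    and Z: "finite Z" "card Z \<le> Suc k" "Z \<subseteq> content_ideal R g" "content_ideal R g \<subseteq> sat_hull Z"
    and T: "saturated T"
    and D: "(content_ideal R f [^]\<^bsub>ideals_set R\<^esub> k) \<cdot>
      content_ideal R (f \<otimes>\<^bsub>power_series R\<^esub> g) \<subseteq> T"
  shows "(content_ideal R f [^]\<^bsub>ideals_set R\<^esub> Suc k) \<cdot> content_ideal R g \<subseteq> T"
proof -
  let ?A = "content_ideal R f" and ?C = "content_ideal R g"
  let ?P = "\<lambda>n. ?A [^]\<^bsub>ideals_set R\<^esub> (n::nat)"
  have A: "ideal ?A R" and C: "ideal ?C R" and P: "ideal (?P n) R" for n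
    using f g by (simp_all add: content_ideal_ideal ideal_pow_ideal)
  have "ideal (?P (Suc k) \<cdot> ?C) R"
    using P C by (rule ideal_prod_is_ideal)
  then obtain W where W: "W \<subseteq> carrier R" "finite W" "?P (Suc k) \<cdot> ?C = Idl W"
    using noetherian_ring.finetely_gen[OF noeth] by blast
  let ?Y = "T \<union> (\<Union>w\<in>W. (\<lambda>m. m \<otimes> w) ` I)"
  have Yc: "?Y \<subseteq> carrier R"
    using W(1) ideal_carr[OF saturated_ideal[OF T]] Icarr by auto
  let ?B = "{m \<otimes> c | m c. m \<in> I \<and> c \<in> ?C}"
  have Bc: "?B \<subseteq> carrier R"
    using Icarr ideal_carr[OF C] by auto
  have Zc: "Z \<subseteq> carrier R"
    using Z(3) ideal_carr[OF C] by blast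
  have Y: "saturated (sat_hull ?Y)"
    using Yc by (rule saturated_sat_hull)
  have "?P (Suc k) \<cdot> ?C \<subseteq> sat_hull ?Y"
  proof (rule ideal_prod_subsetI[OF saturated_ideal[OF Y]],
      rule content_pow_mult_modulo[OF f g Bc Z(1-3) _ _ Y])
    show "m \<otimes> c \<in> sat_hull ?B" if "m \<in> I" "c \<in> ?C" for m c
      using that sat_hull_superset[of ?B] by blast
    show "?C \<subseteq> sat_hull (?B \<union> Z)"
      using Z(4) sat_hull_mono[of Z "?B \<union> Z"] Bc Zc by blast
  next
    fix l x n assume "Suc k = Suc l" "x \<in> ?P l"
    then have "x \<otimes> (f \<otimes>\<^bsub>power_series R\<^esub> g) n \<in> T"
      using subsetD[OF D ideal_prod.prod] coeff_in_content[OF power_series_mult_closed[OF f g]]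
      by simp
    then show "x \<otimes> (f \<otimes>\<^bsub>power_series R\<^esub> g) n \<in> sat_hull ?Y"
      using sat_hull_superset[of ?Y] by blast
  next
    fix x b assume x: "x \<in> ?P (Suc k)" and "b \<in> ?B"
    then obtain m c where b: "b = m \<otimes> c" and m: "m \<in> I" and c: "c \<in> ?C"
      by blast
    have "m \<otimes> (x \<otimes> c) \<in> sat_hull ?Y"
    proof (rule genideal_colonI[OF saturated_ideal[OF Y] Icarr[OF m] W(1)])
      show "m \<otimes> w \<in> sat_hull ?Y" if "w \<in> W" for w
        using that m sat_hull_superset[of ?Y] by blast
      show "x \<otimes> c \<in> Idl W"
        using x c ideal_prod.prod[of x "?P (Suc k)" c ?C R] W(3) by simp
    qed
    then show "x \<otimes> b \<in> sat_hull ?Y"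
      using ideal_carr[OF P x] ideal_carr[OF C c] Icarr[OF m] b by (simp add: m_lcomm)
  qed
  then have "W \<subseteq> sat_hull ?Y"
    using W genideal_self by blast
  then have "W \<subseteq> T"
    using saturated_nakayama[OF W(2,1) T] by blast
  then show ?thesis
    unfolding W(3) using genideal_minimal saturated_ideal[OF T] by blast
qed

section \<open>Localization\<close>

context multiplicative_set
begin

abbreviation L :: "('a \<times> 'a) set ring"
  where "L \<equiv> localization R S"

lemma mem_fraction_iff:
  "(b, t) \<in> fraction R S a s \<longleftrightarrow>
    a \<in> carrier R \<and> s \<in> S \<and> b \<in> carrier R \<and> t \<in> S \<and> (\<exists>u\<in>S. u \<otimes> (t \<otimes> a) = u \<otimes> (s \<otimes> b))"
  by (simp add: fraction_def fraction_rel_def)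

lemma mem_fraction_self: "\<lbrakk>a \<in> carrier R; s \<in> S\<rbrakk> \<Longrightarrow> (a, s) \<in> fraction R S a s"
  using S_one by (auto simp: mem_fraction_iff)

lemma fraction_subset:
  assumes "a \<in> carrier R" "b \<in> carrier R" "s \<in> S" "t \<in> S" "u \<in> S"
    and ab: "u \<otimes> (t \<otimes> a) = u \<otimes> (s \<otimes> b)"
  shows "fraction R S a s \<subseteq> fraction R S b t"
proof clarify
  fix c r assume "(c, r) \<in> fraction R S a s"
  then obtain v where v: "v \<in> S" "v \<otimes> (r \<otimes> a) = v \<otimes> (s \<otimes> c)" and c: "c \<in> carrier R" "r \<in> S"
    by (auto simp: mem_fraction_iff)
  note [simp] = S_carr assms(1-5) v(1) c
  have "(u \<otimes> v \<otimes> s) \<otimes> (r \<otimes> b) = (v \<otimes> r) \<otimes> (u \<otimes> (s \<otimes> b))"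
    by (simp add: m_ac)
  also have "\<dots> = (v \<otimes> r) \<otimes> (u \<otimes> (t \<otimes> a))"
    by (simp only: ab)
  also have "\<dots> = (u \<otimes> t) \<otimes> (v \<otimes> (r \<otimes> a))"
    by (simp add: m_ac)
  also have "\<dots> = (u \<otimes> t) \<otimes> (v \<otimes> (s \<otimes> c))"
    by (simp only: v)
  also have "\<dots> = (u \<otimes> v \<otimes> s) \<otimes> (t \<otimes> c)"
    by (simp add: m_ac)
  finally show "(c, r) \<in> fraction R S b t"
    unfolding mem_fraction_iff using S_mult by auto
qed

lemma fraction_eqI:
  assumes "a \<in> carrier R" "b \<in> carrier R" "s \<in> S" "t \<in> S" "u \<in> S"
    and "u \<otimes> (t \<otimes> a) = u \<otimes> (s \<otimes> b)"
  shows "fraction R S a s = fraction R S b t"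
  using fraction_subset[OF assms] fraction_subset[OF assms(2,1,4,3,5) assms(6)[symmetric]] by blast

lemma fraction_eqD:
  assumes "fraction R S a s = fraction R S b t" "b \<in> carrier R" "t \<in> S"
  obtains u where "u \<in> S" "u \<otimes> (t \<otimes> a) = u \<otimes> (s \<otimes> b)"
  using mem_fraction_self[OF assms(2,3)] that unfolding assms(1)[symmetric] mem_fraction_iff by blast

lemma localization_carrier: "carrier L = {fraction R S a s | a s. a \<in> carrier R \<and> s \<in> S}"
  by (auto simp: localization_def quotient_def fraction_def)

lemma fraction_in_carrier [simp]:
  "\<lbrakk>a \<in> carrier R; s \<in> S\<rbrakk> \<Longrightarrow> fraction R S a s \<in> carrier L"
  by (auto simp: localization_carrier)

lemma localization_cases [consumes 1]:
  assumes "x \<in> carrier L"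
  obtains a s where "a \<in> carrier R" "s \<in> S" "x = fraction R S a s"
  using assms by (auto simp: localization_carrier)

lemma UN_fraction:
  assumes "a \<in> carrier R" "s \<in> S" "b \<in> carrier R" "t \<in> S"
    and F: "\<And>a' s' b' t'. \<lbrakk>(a', s') \<in> fraction R S a s; (b', t') \<in> fraction R S b t\<rbrakk> \<Longrightarrow>
      F a' s' b' t' = F a s b t"
  shows "(\<Union>(a', s')\<in>fraction R S a s. \<Union>(b', t')\<in>fraction R S b t. F a' s' b' t') = F a s b t"
    (is "?U = _")
proof
  show "?U \<subseteq> F a s b t"
    using F by blast
  show "F a s b t \<subseteq> ?U"
    using mem_fraction_self[OF assms(1,2)] mem_fraction_self[OF assms(3,4)] by blast
qed

lemma localization_mult:
  assumes "a \<in> carrier R" "s \<in> S" "b \<in> carrier R" "t \<in> S"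
  shows "fraction R S a s \<otimes>\<^bsub>L\<^esub> fraction R S b t = fraction R S (a \<otimes> b) (s \<otimes> t)"
  unfolding localization_def monoid.simps
proof (rule UN_fraction[OF assms])
  fix a' s' b' t' assume "(a', s') \<in> fraction R S a s" "(b', t') \<in> fraction R S b t"
  then obtain u v where c: "a' \<in> carrier R" "s' \<in> S" "b' \<in> carrier R" "t' \<in> S" "u \<in> S" "v \<in> S"
    and u: "u \<otimes> (s' \<otimes> a) = u \<otimes> (s \<otimes> a')" and v: "v \<otimes> (t' \<otimes> b) = v \<otimes> (t \<otimes> b')"
    by (auto simp: mem_fraction_iff)
  note [simp] = S_carr assms c
  have "(u \<otimes> v) \<otimes> ((s \<otimes> t) \<otimes> (a' \<otimes> b')) = (u \<otimes> (s \<otimes> a')) \<otimes> (v \<otimes> (t \<otimes> b'))"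
    by (simp add: m_ac)
  also have "\<dots> = (u \<otimes> (s' \<otimes> a)) \<otimes> (v \<otimes> (t' \<otimes> b))"
    by (simp only: u v)
  also have "\<dots> = (u \<otimes> v) \<otimes> ((s' \<otimes> t') \<otimes> (a \<otimes> b))"
    by (simp add: m_ac)
  finally show "fraction R S (a' \<otimes> b') (s' \<otimes> t') = fraction R S (a \<otimes> b) (s \<otimes> t)"
    by (intro fraction_eqI[where u = "u \<otimes> v"]) (simp_all add: S_mult)
qed

lemma localization_add:
  assumes "a \<in> carrier R" "s \<in> S" "b \<in> carrier R" "t \<in> S"
  shows "fraction R S a s \<oplus>\<^bsub>L\<^esub> fraction R S b t = fraction R S ((t \<otimes> a) \<oplus> (s \<otimes> b)) (s \<otimes> t)"
  unfolding localization_def ring_record_simps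
proof (rule UN_fraction[OF assms])
  fix a' s' b' t' assume "(a', s') \<in> fraction R S a s" "(b', t') \<in> fraction R S b t"
  then obtain u v where c: "a' \<in> carrier R" "s' \<in> S" "b' \<in> carrier R" "t' \<in> S" "u \<in> S" "v \<in> S"
    and u: "u \<otimes> (s' \<otimes> a) = u \<otimes> (s \<otimes> a')" and v: "v \<otimes> (t' \<otimes> b) = v \<otimes> (t \<otimes> b')"
    by (auto simp: mem_fraction_iff)
  note [simp] = S_carr assms c
  have "(u \<otimes> v) \<otimes> ((s \<otimes> t) \<otimes> (t' \<otimes> a' \<oplus> s' \<otimes> b')) =
      (v \<otimes> t \<otimes> t') \<otimes> (u \<otimes> (s \<otimes> a')) \<oplus> (u \<otimes> s \<otimes> s') \<otimes> (v \<otimes> (t \<otimes> b'))"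
    by (simp add: r_distr m_ac)
  also have "\<dots> = (v \<otimes> t \<otimes> t') \<otimes> (u \<otimes> (s' \<otimes> a)) \<oplus> (u \<otimes> s \<otimes> s') \<otimes> (v \<otimes> (t' \<otimes> b))"
    by (simp only: u v)
  also have "\<dots> = (u \<otimes> v) \<otimes> ((s' \<otimes> t') \<otimes> (t \<otimes> a \<oplus> s \<otimes> b))"
    by (simp add: r_distr m_ac)
  finally show "fraction R S (t' \<otimes> a' \<oplus> s' \<otimes> b') (s' \<otimes> t') = fraction R S (t \<otimes> a \<oplus> s \<otimes> b) (s \<otimes> t)"
    by (intro fraction_eqI[where u = "u \<otimes> v"]) (simp_all add: S_mult)
qed

lemma localization_one: "\<one>\<^bsub>L\<^esub> = fraction R S \<one> \<one>"
  and localization_zero: "\<zero>\<^bsub>L\<^esub> = fraction R S \<zero> \<one>"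
  by (simp_all add: localization_def)

lemmas localization_simps =
  localization_mult localization_add localization_one localization_zero

lemma cring_localization: "cring L"
proof (rule cringI)
  note [simp] = S_carr S_one S_mult localization_simps
  show "abelian_group L"
  proof (rule abelian_groupI)
    fix x assume "x \<in> carrier L"
    then show "\<zero>\<^bsub>L\<^esub> \<oplus>\<^bsub>L\<^esub> x = x"
      by (cases rule: localization_cases) simp
    from \<open>x \<in> carrier L\<close> obtain a s where x: "a \<in> carrier R" "s \<in> S" "x = fraction R S a s"
      by (rule localization_cases)
    have "fraction R S (s \<otimes> \<ominus> a \<oplus> s \<otimes> a) (s \<otimes> s) = fraction R S \<zero> \<one>"
      using x by (intro fraction_eqI[where u = \<one>]) (simp_all add: r_minus l_neg)
    with x have "fraction R S (\<ominus> a) s \<oplus>\<^bsub>L\<^esub> x = \<zero>\<^bsub>L\<^esub>"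
      by simp
    with x show "\<exists>y\<in>carrier L. y \<oplus>\<^bsub>L\<^esub> x = \<zero>\<^bsub>L\<^esub>"
      by (intro bexI[of _ "fraction R S (\<ominus> a) s"]) simp_all
  next
    fix x y assume "x \<in> carrier L" "y \<in> carrier L"
    then obtain a s b t where xy: "a \<in> carrier R" "s \<in> S" "x = fraction R S a s"
        "b \<in> carrier R" "t \<in> S" "y = fraction R S b t"
      by (metis localization_cases)
    then show "x \<oplus>\<^bsub>L\<^esub> y \<in> carrier L"
      by simp
    from xy show "x \<oplus>\<^bsub>L\<^esub> y = y \<oplus>\<^bsub>L\<^esub> x"
      by (simp add: a_comm m_comm)
    fix z assume "z \<in> carrier L"
    then obtain c r where "c \<in> carrier R" "r \<in> S" "z = fraction R S c r"
      by (rule localization_cases)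
    with xy show "(x \<oplus>\<^bsub>L\<^esub> y) \<oplus>\<^bsub>L\<^esub> z = x \<oplus>\<^bsub>L\<^esub> (y \<oplus>\<^bsub>L\<^esub> z)"
      by (simp add: r_distr m_ac a_ac)
  qed simp
  show "Group.comm_monoid L"
  proof (rule comm_monoidI)
    fix x assume "x \<in> carrier L"
    then show "\<one>\<^bsub>L\<^esub> \<otimes>\<^bsub>L\<^esub> x = x"
      by (cases rule: localization_cases) simp
  next
    fix x y assume "x \<in> carrier L" "y \<in> carrier L"
    then obtain a s b t where xy: "a \<in> carrier R" "s \<in> S" "x = fraction R S a s"
        "b \<in> carrier R" "t \<in> S" "y = fraction R S b t"
      by (metis localization_cases)
    then show "x \<otimes>\<^bsub>L\<^esub> y \<in> carrier L"
      by simp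
    from xy show "x \<otimes>\<^bsub>L\<^esub> y = y \<otimes>\<^bsub>L\<^esub> x"
      by (simp add: m_comm)
    fix z assume "z \<in> carrier L"
    then obtain c r where "c \<in> carrier R" "r \<in> S" "z = fraction R S c r"
      by (rule localization_cases)
    with xy show "(x \<otimes>\<^bsub>L\<^esub> y) \<otimes>\<^bsub>L\<^esub> z = x \<otimes>\<^bsub>L\<^esub> (y \<otimes>\<^bsub>L\<^esub> z)"
      by (simp add: m_assoc)
  qed simp
next
  note [simp] = S_carr S_one S_mult
  fix x y z assume "x \<in> carrier L" "y \<in> carrier L" "z \<in> carrier L"
  then obtain a s b t c r where xyz: "a \<in> carrier R" "s \<in> S" "x = fraction R S a s"
      "b \<in> carrier R" "t \<in> S" "y = fraction R S b t"
      "c \<in> carrier R" "r \<in> S" "z = fraction R S c r"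
    by (metis localization_cases)
  then show "(x \<oplus>\<^bsub>L\<^esub> y) \<otimes>\<^bsub>L\<^esub> z = x \<otimes>\<^bsub>L\<^esub> z \<oplus>\<^bsub>L\<^esub> y \<otimes>\<^bsub>L\<^esub> z"
    by (simp add: localization_simps, intro fraction_eqI[where u = \<one>])
      (simp_all add: l_distr r_distr m_ac)
qed

lemma localize_idealI: "\<lbrakk>a \<in> J; s \<in> S\<rbrakk> \<Longrightarrow> fraction R S a s \<in> localize_ideal R S J"
  by (auto simp: localize_ideal_def)

lemma ideal_localize_ideal:
  assumes J: "ideal J R"
  shows "ideal (localize_ideal R S J) L"
proof (rule cring.ideal_cringI[OF cring_localization])
  note [simp] = S_carr S_one S_mult localization_simps ideal_carr[OF J]
  show "localize_ideal R S J \<subseteq> carrier L"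
    by (auto simp: localize_ideal_def)
  show "\<zero>\<^bsub>L\<^esub> \<in> localize_ideal R S J"
    using ideal_zero[OF J] by (simp add: localize_idealI)
  fix x y assume "y \<in> localize_ideal R S J"
  then obtain b t where y: "y = fraction R S b t" "b \<in> J" "t \<in> S"
    by (auto simp: localize_ideal_def)
  {
    assume "x \<in> localize_ideal R S J"
    then obtain a s where x: "x = fraction R S a s" "a \<in> J" "s \<in> S"
      by (auto simp: localize_ideal_def)
    have "t \<otimes> a \<oplus> s \<otimes> b \<in> J"
      using x y by (intro ideal_add[OF J] ideal_l[OF J]) simp_all
    with x y show "x \<oplus>\<^bsub>L\<^esub> y \<in> localize_ideal R S J"
      by (simp add: localize_idealI)
  next
    assume "x \<in> carrier L"
    then obtain a s where x: "a \<in> carrier R" "s \<in> S" "x = fraction R S a s"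
      by (rule localization_cases)
    have "a \<otimes> b \<in> J"
      using x y by (intro ideal_l[OF J])
    with x y show "x \<otimes>\<^bsub>L\<^esub> y \<in> localize_ideal R S J"
      by (simp add: localize_idealI)
  }
qed

lemma fraction_in_localize_saturated:
  assumes T: "saturated T" and "a \<in> carrier R" "s \<in> S" "fraction R S a s \<in> localize_ideal R S T"
  shows "a \<in> T"
proof -
  obtain b t where b: "fraction R S a s = fraction R S b t" "b \<in> T" "t \<in> S"
    using assms(4) by (auto simp: localize_ideal_def)
  note Ti = saturated_ideal[OF T]
  obtain u where u: "u \<in> S" "u \<otimes> (t \<otimes> a) = u \<otimes> (s \<otimes> b)"
    using fraction_eqD[OF b(1)] b ideal_carr[OF Ti] by blast
  moreover have "u \<otimes> (s \<otimes> b) \<in> T"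
    using u b assms(3) by (intro ideal_l[OF Ti]) (simp_all add: S_carr)
  ultimately have "(u \<otimes> t) \<otimes> a \<in> T"
    using assms(2) b(3) by (simp add: m_assoc S_carr)
  then show ?thesis
    by (rule saturatedD[OF T S_mult[OF u(1) b(3)] assms(2)])
qed

lemma genideal_fractions:
  assumes A: "A \<subseteq> carrier R"
  shows "Idl\<^bsub>L\<^esub> ((\<lambda>a. fraction R S a \<one>) ` A) = localize_ideal R S (Idl A)" (is "Idl\<^bsub>L\<^esub> ?F = _")
proof
  interpret L: cring L
    by (rule cring_localization)
  note [simp] = S_carr S_one S_mult localization_simps
  have Fc: "?F \<subseteq> carrier L"
    using A by auto
  have "?F \<subseteq> localize_ideal R S (Idl A)"
    using genideal_self[OF A] S_one localize_idealI by blast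
  then show "Idl\<^bsub>L\<^esub> ?F \<subseteq> localize_ideal R S (Idl A)"
    by (intro L.genideal_minimal ideal_localize_ideal genideal_ideal A)
  let ?J = "Idl\<^bsub>L\<^esub> ?F"
  note J = L.genideal_ideal[OF Fc]
  have "ideal {a \<in> carrier R. fraction R S a \<one> \<in> ?J} R"
  proof (rule ideal_cringI)
    show "\<zero> \<in> {a \<in> carrier R. fraction R S a \<one> \<in> ?J}"
      using ideal_zero[OF J] by simp
  next
    fix a b assume "a \<in> {a \<in> carrier R. fraction R S a \<one> \<in> ?J}" "b \<in> {a \<in> carrier R. fraction R S a \<one> \<in> ?J}"
    then show "a \<oplus> b \<in> {a \<in> carrier R. fraction R S a \<one> \<in> ?J}"
      using ideal_add[OF J, of "fraction R S a \<one>" "fraction R S b \<one>"] by simp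
  next
    fix r a assume "r \<in> carrier R" "a \<in> {a \<in> carrier R. fraction R S a \<one> \<in> ?J}"
    then show "r \<otimes> a \<in> {a \<in> carrier R. fraction R S a \<one> \<in> ?J}"
      using ideal_l[OF J, of "fraction R S r \<one>" "fraction R S a \<one>"] by simp
  qed auto
  moreover have "A \<subseteq> {a \<in> carrier R. fraction R S a \<one> \<in> ?J}"
    using A L.genideal_self[OF Fc] by auto
  ultimately have sub: "Idl A \<subseteq> {a \<in> carrier R. fraction R S a \<one> \<in> ?J}"
    by (rule genideal_minimal)
  show "localize_ideal R S (Idl A) \<subseteq> ?J"
  proof
    fix x assume "x \<in> localize_ideal R S (Idl A)"
    then obtain a s where x: "x = fraction R S a s" "a \<in> Idl A" "s \<in> S"
      by (auto simp: localize_ideal_def)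
    moreover have "a \<in> carrier R" "fraction R S a \<one> \<in> ?J"
      using sub x by auto
    ultimately show "x \<in> ?J"
      using ideal_l[OF J, of "fraction R S \<one> s" "fraction R S a \<one>"] by simp
  qed
qed

lemma min_gens_localize_le:
  assumes "A \<subseteq> carrier R" "finite A"
  shows "min_gens L (localize_ideal R S (Idl A)) \<le> card A"
proof -
  have "min_gens L (localize_ideal R S (Idl A)) \<le> card ((\<lambda>a. fraction R S a \<one>) ` A)"
    unfolding min_gens_def
    by (rule Least_le, rule exI[of _ "(\<lambda>a. fraction R S a \<one>) ` A"])
      (use assms S_one genideal_fractions in auto)
  then show ?thesis
    using card_image_le[OF assms(2)] by (rule order_trans)
qed

lemma min_gens_localize_hull:
  assumes A: "A \<subseteq> carrier R" "finite A" and J: "J = Idl A"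
  obtains Z where "finite Z" "card Z \<le> min_gens L (localize_ideal R S J)" "Z \<subseteq> J" "J \<subseteq> sat_hull Z"
proof -
  have Ji: "ideal J R"
    unfolding J using A(1) by (rule genideal_ideal)
  let ?gen = "\<lambda>n. \<exists>B. B \<subseteq> carrier L \<and> finite B \<and> card B = n \<and> Idl\<^bsub>L\<^esub> B = localize_ideal R S J"
  have "?gen (card ((\<lambda>a. fraction R S a \<one>) ` A))"
    by (rule exI[of _ "(\<lambda>a. fraction R S a \<one>) ` A"])
      (use A S_one genideal_fractions J in auto)
  then have "?gen (min_gens L (localize_ideal R S J))"
    unfolding min_gens_def by (rule LeastI)
  then obtain B where B: "B \<subseteq> carrier L" "finite B"
      "card B = min_gens L (localize_ideal R S J)" "Idl\<^bsub>L\<^esub> B = localize_ideal R S J"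
    by blast
  interpret L: cring L
    by (rule cring_localization)
  have "\<forall>x\<in>B. \<exists>a. a \<in> J \<and> (\<exists>s\<in>S. x = fraction R S a s)"
    using L.genideal_self[OF B(1)] B(4) by (auto simp: localize_ideal_def)
  then obtain num where num: "\<And>x. x \<in> B \<Longrightarrow> num x \<in> J" "\<And>x. x \<in> B \<Longrightarrow> \<exists>s\<in>S. x = fraction R S (num x) s"
    by metis
  have ZJ: "num ` B \<subseteq> J"
    using num by blast
  then have "num ` B \<subseteq> carrier R"
    using ideal_carr[OF Ji] by blast
  then have H: "saturated (sat_hull (num ` B))"
    by (rule saturated_sat_hull)
  have "B \<subseteq> localize_ideal R S (sat_hull (num ` B))"
    using num(2) sat_hull_superset[of "num ` B"] unfolding localize_ideal_def by blast
  then have "localize_ideal R S J \<subseteq> localize_ideal R S (sat_hull (num ` B))"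
    unfolding B(4)[symmetric] by (intro L.genideal_minimal ideal_localize_ideal saturated_ideal[OF H])
  then have "c \<in> sat_hull (num ` B)" if "c \<in> J" for c
    using that S_one ideal_carr[OF Ji that]
      localize_idealI[OF that S_one]
    by (intro fraction_in_localize_saturated[OF H, of c \<one>]) auto
  then show ?thesis
    using that[of "num ` B"] B(2,3) ZJ card_image_le[OF B(2), of num] by auto
qed

end

section \<open>Passage from local to global\<close>

lemma (in multiplicative_set) saturated_saturation:
  assumes J: "ideal J R"
  shows "saturated {x \<in> carrier R. \<exists>s\<in>S. s \<otimes> x \<in> J}" (is "saturated ?T")
  unfolding saturated_def
proof (intro conjI ballI impI)
  note [simp] = S_carr ideal_carr[OF J]
  have TI: "v \<in> ?T" if "v \<in> carrier R" "s \<in> S" "s \<otimes> v \<in> J" for v s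
    using that by blast
  show "ideal ?T R"
  proof (rule ideal_cringI)
    show "\<zero> \<in> ?T"
      using S_one ideal_zero[OF J] by (intro TI[of _ \<one>]) simp_all
  next
    fix v w assume "v \<in> ?T" "w \<in> ?T"
    then obtain s t where vw: "v \<in> carrier R" "s \<in> S" "s \<otimes> v \<in> J" "w \<in> carrier R" "t \<in> S" "t \<otimes> w \<in> J"
      by blast
    then have "t \<otimes> (s \<otimes> v) \<oplus> s \<otimes> (t \<otimes> w) \<in> J"
      by (intro ideal_add[OF J ideal_l[OF J] ideal_l[OF J]]) simp_all
    then have "(s \<otimes> t) \<otimes> (v \<oplus> w) \<in> J"
      using vw by (simp add: r_distr m_ac)
    with vw show "v \<oplus> w \<in> ?T"
      by (intro TI[of _ "s \<otimes> t"]) (simp_all add: S_mult)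
  next
    fix r v assume r: "r \<in> carrier R" and "v \<in> ?T"
    then obtain s where v: "v \<in> carrier R" "s \<in> S" "s \<otimes> v \<in> J"
      by blast
    then have "s \<otimes> (r \<otimes> v) \<in> J"
      using r ideal_l[OF J r v(3)] by (simp add: m_lcomm)
    with v r show "r \<otimes> v \<in> ?T"
      by (intro TI) simp_all
  qed auto
  fix s v assume s: "s \<in> S" and v: "v \<in> carrier R" "s \<otimes> v \<in> ?T"
  then obtain t where "t \<in> S" "t \<otimes> (s \<otimes> v) \<in> J"
    by blast
  with s v(1) show "v \<in> ?T"
    by (intro TI[of _ "t \<otimes> s"]) (simp_all add: S_mult m_assoc)
qed

lemma (in cring) exists_maximalideal:
  assumes J: "ideal J R" and one: "\<one> \<notin> J"
  obtains M where "maximalideal M R" "J \<subseteq> M"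
proof -
  let ?F = "{K. ideal K R \<and> J \<subseteq> K \<and> \<one> \<notin> K}"
  have "\<exists>M\<in>?F. \<forall>K\<in>?F. M \<subseteq> K \<longrightarrow> K = M"
  proof (rule subset_Zorn_nonempty)
    show "?F \<noteq> {}"
      using J one by blast
    fix C assume C: "C \<noteq> {}" "subset.chain ?F C"
    from C(2) have CF: "C \<subseteq> ?F"
      unfolding subset_chain_def by (rule conjunct1)
    then have "subset.chain {K. ideal K R} C"
      using C(2) unfolding subset_chain_def by blast
    then have "ideal (\<Union>C) R"
      using chain_Union_is_ideal[of C] C(1) by simp
    then show "\<Union>C \<in> ?F"
      using C(1) CF by blast
  qed
  then obtain M where "M \<in> ?F" and M_max: "\<forall>K\<in>?F. M \<subseteq> K \<longrightarrow> K = M"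
    by (rule bexE)
  then have M: "ideal M R" "J \<subseteq> M" "\<one> \<notin> M"
    by simp_all
  have max: "K = M" if "ideal K R" "J \<subseteq> K" "\<one> \<notin> K" "M \<subseteq> K" for K
    using M_max that by simp
  have "maximalideal M R"
  proof (rule maximalidealI[OF M(1)])
    show "carrier R \<noteq> M"
      using M(3) by blast
    show "K = M \<or> K = carrier R" if "ideal K R" "M \<subseteq> K" "K \<subseteq> carrier R" for K
      using that max[of K] M(2) ideal.one_imp_carrier[of K R] by (cases "\<one> \<in> K") simp_all
  qed
  then show ?thesis
    using M(2) that by blast
qed

lemma (in cring) mem_ideal_if_locally:
  assumes J: "ideal J R" and x: "x \<in> carrier R"
    and loc: "\<And>M. maximalideal M R \<Longrightarrow> \<exists>s\<in>carrier R - M. s \<otimes> x \<in> J"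
  shows "x \<in> J"
proof (rule ccontr)
  assume "x \<notin> J"
  then have "\<one> \<notin> colon R J x"
    using x by (simp add: colon_def)
  then obtain M where M: "maximalideal M R" "colon R J x \<subseteq> M"
    using exists_maximalideal[OF ideal_colon[OF J x]] by blast
  then obtain s where "s \<in> carrier R - M" "s \<otimes> x \<in> J"
    using loc by blast
  then show False
    using M(2) x by (auto simp: colon_def m_comm)
qed

lemma (in primeideal) min_gens_at_hull:
  assumes "A \<subseteq> carrier R" "finite A" "J = Idl A"
  obtains Z where "finite Z" "card Z \<le> min_gens (localization_at R I) (localize_ideal_at R I J)"
    "Z \<subseteq> J" "J \<subseteq> sat_hull Z"
  using min_gens_localize_hull[OF assms]
  unfolding localization_at_def localize_ideal_at_def by blast

lemma (in cring) local_min_gens_le: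
  assumes A: "A \<subseteq> carrier R" "finite A" and n: "n \<in> local_min_gens R (Idl A)"
  shows "n \<le> card A"
proof -
  obtain M where M: "maximalideal M R"
      and n_eq: "n = min_gens (localization_at R M) (localize_ideal_at R M (Idl A))"
    using n by (auto simp: local_min_gens_def)
  interpret primeideal M R
    using M by (rule maximalideal_prime)
  show ?thesis
    unfolding n_eq localization_at_def localize_ideal_at_def using A by (rule min_gens_localize_le)
qed

lemma min_gens_attained:
  assumes "A \<subseteq> carrier R" "finite A" "J = Idl\<^bsub>R\<^esub> A"
  obtains B where "B \<subseteq> carrier R" "finite B" "card B = min_gens R J" "J = Idl\<^bsub>R\<^esub> B"
proof -
  have "\<exists>B. B \<subseteq> carrier R \<and> finite B \<and> card B = min_gens R J \<and> Idl\<^bsub>R\<^esub> B = J"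
    unfolding min_gens_def by (rule LeastI_ex) (use assms in blast)
  then show ?thesis
    using that by blast
qed

lemma (in cring) zero_ideal_if_locally_zero:
  assumes A: "A \<subseteq> carrier R" "finite A" and zero: "\<And>n. n \<in> local_min_gens R (Idl A) \<Longrightarrow> n = 0"
  shows "Idl A \<subseteq> {\<zero>}"
proof
  fix c assume c: "c \<in> Idl A"
  show "c \<in> {\<zero>}"
  proof (rule mem_ideal_if_locally[OF zeroideal])
    show "c \<in> carrier R"
      using ideal_carr[OF genideal_ideal[OF A(1)] c] .
    fix M assume M: "maximalideal M R"
    interpret primeideal M R
      using M by (rule maximalideal_prime)
    obtain Z where Z: "finite Z" "card Z \<le> min_gens (localization_at R M) (localize_ideal_at R M (Idl A))"
        "Z \<subseteq> Idl A" "Idl A \<subseteq> sat_hull Z"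
      using min_gens_at_hull[OF A refl] .
    have "min_gens (localization_at R M) (localize_ideal_at R M (Idl A)) = 0"
      using M by (intro zero) (auto simp: local_min_gens_def)
    then have "Z = {}"
      using Z(1,2) by simp
    then have "Idl A \<subseteq> {x \<in> carrier R. \<exists>s\<in>carrier R - M. s \<otimes> x \<in> {\<zero>}}"
      using Z(4) sat_hull_least[OF saturated_saturation[OF zeroideal], of "{}"] by blast
    then show "\<exists>s\<in>carrier R - M. s \<otimes> c \<in> {\<zero>}"
      using c by blast
  qed
qed

lemma (in cring) content_pow_mult_subset:
  assumes f: "f \<in> UNIV \<rightarrow> carrier R" and g: "g \<in> UNIV \<rightarrow> carrier R"
    and noeth: "noetherian_ring R"
    and le: "\<And>n. n \<in> local_min_gens R (content_ideal R g) \<Longrightarrow> n \<le> Suc k"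
  shows "(content_ideal R f [^]\<^bsub>ideals_set R\<^esub> Suc k) \<cdot> content_ideal R g \<subseteq>
    (content_ideal R f [^]\<^bsub>ideals_set R\<^esub> k) \<cdot> content_ideal R (f \<otimes>\<^bsub>power_series R\<^esub> g)"
    (is "?E \<subseteq> ?D")
proof
  have C: "ideal (content_ideal R g) R" and E: "ideal ?E R" and D: "ideal ?D R"
    using power_series_mult_closed[OF f g] f g
    by (simp_all add: content_ideal_ideal ideal_pow_ideal ideal_prod_is_ideal del: nat_pow_Suc)
  obtain A where A: "A \<subseteq> carrier R" "finite A" "content_ideal R g = Idl A"
    using noetherian_ring.finetely_gen[OF noeth C] by blast
  fix x assume x: "x \<in> ?E"
  show "x \<in> ?D"
  proof (rule mem_ideal_if_locally[OF D ideal_carr[OF E x]])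
    fix M assume M: "maximalideal M R"
    interpret primeideal M R
      using M by (rule maximalideal_prime)
    obtain Z where Z: "finite Z" "Z \<subseteq> content_ideal R g" "content_ideal R g \<subseteq> sat_hull Z"
        "card Z \<le> min_gens (localization_at R M) (localize_ideal_at R M (content_ideal R g))"
      using min_gens_at_hull[OF A] by metis
    have "min_gens (localization_at R M) (localize_ideal_at R M (content_ideal R g)) \<le> Suc k"
      using M by (intro le) (auto simp: local_min_gens_def)
    then have card: "card Z \<le> Suc k"
      using Z(4) by simp
    have "?D \<subseteq> {x \<in> carrier R. \<exists>s\<in>carrier R - M. s \<otimes> x \<in> ?D}"
      using S_one ideal_carr[OF D] by (auto intro!: bexI[of _ \<one>])
    then have "?E \<subseteq> {x \<in> carrier R. \<exists>s\<in>carrier R - M. s \<otimes> x \<in> ?D}"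
      by (rule content_pow_mult_local[OF f g noeth Z(1) card Z(2,3) saturated_saturation[OF D]])
    then show "\<exists>s\<in>carrier R - M. s \<otimes> x \<in> ?D"
      using x by blast
  qed
qed

lemma (in cring) content_pow_mult_supset:
  assumes f: "f \<in> UNIV \<rightarrow> carrier R" and g: "g \<in> UNIV \<rightarrow> carrier R"
  shows "(content_ideal R f [^]\<^bsub>ideals_set R\<^esub> (k::nat)) \<cdot> content_ideal R (f \<otimes>\<^bsub>power_series R\<^esub> g) \<subseteq>
    (content_ideal R f [^]\<^bsub>ideals_set R\<^esub> Suc k) \<cdot> content_ideal R g"
proof -
  have A: "ideal (content_ideal R f) R" and C: "ideal (content_ideal R g) R"
    and P: "ideal (content_ideal R f [^]\<^bsub>ideals_set R\<^esub> k) R"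
    using f g by (simp_all add: content_ideal_ideal ideal_pow_ideal)
  have "(content_ideal R f [^]\<^bsub>ideals_set R\<^esub> k) \<cdot> content_ideal R (f \<otimes>\<^bsub>power_series R\<^esub> g) \<subseteq>
      (content_ideal R f [^]\<^bsub>ideals_set R\<^esub> k) \<cdot> (content_ideal R f \<cdot> content_ideal R g)"
  proof (rule ideal_prod_subsetI)
    fix x y
    assume x: "x \<in> content_ideal R f [^]\<^bsub>ideals_set R\<^esub> k"
      and "y \<in> content_ideal R (f \<otimes>\<^bsub>power_series R\<^esub> g)"
    then have "y \<in> content_ideal R f \<cdot> content_ideal R g"
      using content_mult_subset[OF f g] by blast
    with x show "x \<otimes> y \<in> (content_ideal R f [^]\<^bsub>ideals_set R\<^esub> k) \<cdot> (content_ideal R f \<cdot> content_ideal R g)"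
      by (rule ideal_prod.prod)
  qed (intro ideal_prod_is_ideal A C P)
  then show ?thesis
    using ideal_prod_assoc[OF P A C] by simp
qed

theorem theorem2p6:
  fixes R (structure) and g :: "nat \<Rightarrow> 'a" and k :: nat
  assumes "cring R" and "noetherian_ring R"
    and "g \<in> carrier (power_series R)" and "g \<noteq> \<zero>\<^bsub>power_series R\<^esub>"
    and "k = Max (local_min_gens R (content_ideal R g))"
  shows "finite (local_min_gens R (content_ideal R g)) \<and> local_min_gens R (content_ideal R g) \<noteq> {} \<and>
    1 \<le> k \<and> k \<le> min_gens R (content_ideal R g) \<and>
    (\<forall>f \<in> carrier (power_series R).
       (content_ideal R f [^]\<^bsub>ideals_set R\<^esub> k) \<cdot>\<^bsub>R\<^esub> content_ideal R g =
       (content_ideal R f [^]\<^bsub>ideals_set R\<^esub> (k - 1)) \<cdot>\<^bsub>R\<^esub> content_ideal R (f \<otimes>\<^bsub>power_series R\<^esub> g))"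
proof -
  interpret cring R by fact
  let ?C = "content_ideal R g" and ?N = "local_min_gens R (content_ideal R g)"
  have g: "g \<in> UNIV \<rightarrow> carrier R" and g0: "g \<noteq> (\<lambda>n. \<zero>)"
    using assms(3,4) by (simp_all add: power_series_simps)
  obtain A0 where "A0 \<subseteq> carrier R" "finite A0" "?C = Idl A0"
    using noetherian_ring.finetely_gen[OF assms(2) content_ideal_ideal[OF g]] by blast
  then obtain A where A: "A \<subseteq> carrier R" "finite A" "card A = min_gens R ?C" "?C = Idl A"
    using min_gens_attained by metis
  have bound: "n \<le> min_gens R ?C" if "n \<in> ?N" for n
    using local_min_gens_le[OF A(1,2)] A(3,4) that by metis
  then have fin: "finite ?N"
    by (meson finite_nat_set_iff_bounded_le)
  have nonzero: "\<not> ?C \<subseteq> {\<zero>}"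
    using g0 coeff_in_content[OF g] by auto
  then have "\<exists>n\<in>?N. n \<noteq> 0"
    using zero_ideal_if_locally_zero[OF A(1,2)] A(4) by metis
  then obtain n where n: "n \<in> ?N" "n \<noteq> 0"
    by blast
  then have ne: "?N \<noteq> {}"
    by blast
  have k_max: "m \<le> k" if "m \<in> ?N" for m
    using Max_ge[OF fin that] assms(5) by simp
  have k1: "1 \<le> k"
    using k_max[OF n(1)] n(2) by simp
  have "k \<le> min_gens R ?C"
    using Max_in[OF fin ne] bound assms(5) by simp
  moreover have "(content_ideal R f [^]\<^bsub>ideals_set R\<^esub> k) \<cdot> ?C =
       (content_ideal R f [^]\<^bsub>ideals_set R\<^esub> (k - 1)) \<cdot> content_ideal R (f \<otimes>\<^bsub>power_series R\<^esub> g)"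
    if "f \<in> carrier (power_series R)" for f
  proof -
    have f: "f \<in> UNIV \<rightarrow> carrier R"
      using that by (simp add: power_series_simps)
    have k: "Suc (k - 1) = k"
      using k1 by simp
    show ?thesis
      using content_pow_mult_subset[OF f g assms(2), of "k - 1"] k_max
        content_pow_mult_supset[OF f g, of "k - 1"]
      unfolding k by blast
  qed
  ultimately show ?thesis
    using fin ne k1 by blast
qed

end
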